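(* Let $G$ and $H$ be connected graphs, at least one of them non-bipartite, with roots $R_G$ and $R_H$. Then $Res(G\times H,\;R_G\times R_H)$ is the subgraph of $G\times H$ induced on all vertices $(u,v)\in V(G\times H)$ for which \[d(R_G\times R_H,(u,v))=\max_{(g,h)\in V(G\times H)}\;\min_{r_G\in V(R_G),\,r_H\in V(R_H)}\min\{m\in\mathbb{N} : G\text{ has an } r_G\text{–}g \text{ walk of length } m \text{ and } H \text{ has an } r_H\text{–}h\text{ walk of length } m\}.\]
   Context: A root of a connected finite graph $G$ is an induced subgraph $R_G=\langle V_0\rangle$ on a nonempty vertex set $V_0$; with $V_i$ the set of vertices at distance exactly $i$ from $V_0$ and $r$ the largest $i$ with $V_i\ne\emptyset$, the distance-residual graph is $Res(G,R_G)=\langle V_r\rangle$. $d(R,x)=\min_{y\in V(R)}d(y,x)$. $G\times H$ is the direct (tensor) product: vertex set $V(G)\times V(H)$, with $(u,x)\sim(v,y)$ iff $uv\in E(G)$ and $xy\in E(H)$; $R_G\times R_H$ is the subgraph induced on $V(R_G)\times V(R_H)$. *)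

theory Defs
  imports "Graph_Theory.Digraph_Component" "Graph_Theory.Arc_Walk" "HOL-Library.Extended_Nat"
begin

text \<open>
  A finite simple graph is a \<^locale>\<open>graph\<close>: each edge is a pair of opposite arcs, without loops or
  parallel arcs. Distances are \<^typ>\<open>enat\<close>-valued, with \<^term>\<open>\<infinity>\<close> for unreachable vertices.
\<close>

definition bipartite :: "('a,'b) pre_digraph \<Rightarrow> bool" where
  "bipartite G \<longleftrightarrow> (\<exists>A B. verts G = A \<union> B \<and> A \<inter> B = {} \<and>
     (\<forall>e \<in> arcs G. (tail G e \<in> A \<and> head G e \<in> B) \<or> (tail G e \<in> B \<and> head G e \<in> A)))"

definition has_walk :: "('a,'b) pre_digraph \<Rightarrow> 'a \<Rightarrow> 'a \<Rightarrow> nat \<Rightarrow> bool" where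
  "has_walk G u v m \<longleftrightarrow> (\<exists>p. pre_digraph.awalk G u p v \<and> length p = m)"

definition vdist :: "('a,'b) pre_digraph \<Rightarrow> 'a \<Rightarrow> 'a \<Rightarrow> enat" where
  "vdist G u v = Inf {enat m | m. has_walk G u v m}"

definition is_root :: "('a,'b) pre_digraph \<Rightarrow> ('a,'b) pre_digraph \<Rightarrow> bool" where
  "is_root R G \<longleftrightarrow> induced_subgraph R G \<and> verts R \<noteq> {}"

definition root_dist :: "('a,'b) pre_digraph \<Rightarrow> ('a,'b) pre_digraph \<Rightarrow> 'a \<Rightarrow> enat" where
  "root_dist G R x = (MIN y \<in> verts R. vdist G y x)"

definition layer :: "('a,'b) pre_digraph \<Rightarrow> ('a,'b) pre_digraph \<Rightarrow> enat \<Rightarrow> 'a set" where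
  "layer G R i = {x \<in> verts G. root_dist G R x = i}"

text \<open>
  For connected \<open>G\<close> all indices of nonempty layers are finite. Allowing the index \<^term>\<open>\<infinity>\<close> only
  matters for disconnected \<open>G\<close>, where the last layer then consists of the unreachable vertices.
\<close>

definition Res :: "('a,'b) pre_digraph \<Rightarrow> ('a,'b) pre_digraph \<Rightarrow> ('a,'b) pre_digraph" where
  "Res G R = G \<restriction> layer G R (Max {i. layer G R i \<noteq> {}})"

text \<open>
  Taking all pairs of arcs as arcs, \<open>(u,x)\<close> is joined to \<open>(v,y)\<close> iff \<open>u\<close> is joined to \<open>v\<close> and
  \<open>x\<close> to \<open>y\<close>; see \<open>arcs_ends_direct_product\<close>.
\<close>

definition direct_product ::
  "('a,'b) pre_digraph \<Rightarrow> ('c,'d) pre_digraph \<Rightarrow> ('a \<times> 'c, 'b \<times> 'd) pre_digraph" where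
  "direct_product G H = \<lparr> verts = verts G \<times> verts H, arcs = arcs G \<times> arcs H,
     tail = map_prod (tail G) (tail H), head = map_prod (head G) (head H) \<rparr>"

lemma arcs_ends_direct_product:
  "((u,x),(v,y)) \<in> arcs_ends (direct_product G H) \<longleftrightarrow>
     (u,v) \<in> arcs_ends G \<and> (x,y) \<in> arcs_ends H"
  by (force simp: arcs_ends_def arc_to_ends_def direct_product_def)

lemma graph_direct_product:
  assumes "graph G" "graph H"
  shows "graph (direct_product G H)"
proof -
  interpret G: graph G by fact
  interpret H: graph H by fact
  have "sym (arcs_ends (direct_product G H))"
    using G.sym_arcs H.sym_arcs
    by (auto intro!: symI simp: arcs_ends_direct_product symmetric_def dest: symD)
  moreover have "e = e'"
    if "e \<in> arcs (direct_product G H)" "e' \<in> arcs (direct_product G H)"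
      "arc_to_ends (direct_product G H) e = arc_to_ends (direct_product G H) e'" for e e'
    using that G.no_multi_arcs H.no_multi_arcs
    by (cases e; cases e') (auto simp: direct_product_def arc_to_ends_def)
  ultimately show ?thesis
    by unfold_locales (auto simp: direct_product_def symmetric_def dest: G.no_loops)
qed

definition root_product ::
  "('a,'b) pre_digraph \<Rightarrow> ('a,'b) pre_digraph \<Rightarrow> ('c,'d) pre_digraph \<Rightarrow> ('c,'d) pre_digraph
    \<Rightarrow> ('a \<times> 'c, 'b \<times> 'd) pre_digraph" where
  "root_product G R H S = direct_product G H \<restriction> (verts R \<times> verts S)"

end

theory Submission
  imports Defs
begin

text \<open>
  A walk of length \<open>m\<close> in the direct product is exactly a pair of walks of the same length \<open>m\<close> in
  the factors. Hence the iterated minimum over the two roots is the distance to \<open>R\<^sub>G \<times> R\<^sub>H\<close>, and its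
  maximum is the index of the last layer.
\<close>

text \<open>Tails and heads in the product are taken componentwise, so the chaining condition at
  each arc of \<open>p\<close> splits into one condition per factor.\<close>

lemma cas_direct_product:
  "pre_digraph.cas (direct_product G H) (a, b) p (g, h) \<longleftrightarrow>
     pre_digraph.cas G a (map fst p) g \<and> pre_digraph.cas H b (map snd p) h"
  by (induction p arbitrary: a b) (auto simp: pre_digraph.cas.simps direct_product_def)

lemma awalk_direct_product:
  "pre_digraph.awalk (direct_product G H) (a, b) p (g, h) \<longleftrightarrow>
     pre_digraph.awalk G a (map fst p) g \<and> pre_digraph.awalk H b (map snd p) h"
proof -
  have "set p \<subseteq> arcs G \<times> arcs H \<longleftrightarrow> fst ` set p \<subseteq> arcs G \<and> snd ` set p \<subseteq> arcs H"
    by force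
  then show ?thesis
    \<comment> \<open>The product is unfolded only in the second call, so that
      \<open>cas_direct_product\<close> still matches in the first.\<close>
    by (auto simp: pre_digraph.awalk_def cas_direct_product) (auto simp: direct_product_def)
qed

lemma has_walk_direct_product:
  "has_walk (direct_product G H) (a, b) (g, h) m \<longleftrightarrow> has_walk G a g m \<and> has_walk H b h m"
proof
  assume "has_walk (direct_product G H) (a, b) (g, h) m"
  then show "has_walk G a g m \<and> has_walk H b h m"
    by (metis awalk_direct_product has_walk_def length_map)
next
  assume "has_walk G a g m \<and> has_walk H b h m"
  then obtain p q where p: "pre_digraph.awalk G a p g" "length p = m"
    and q: "pre_digraph.awalk H b q h" "length q = m"
    by (auto simp: has_walk_def)
  \<comment> \<open>Since \<open>p\<close> and \<open>q\<close> have equal length,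
    \<open>zip\<close> truncates neither, and its projections are \<open>p\<close> and
    \<open>q\<close> again.\<close>
  then have "pre_digraph.awalk (direct_product G H) (a, b) (zip p q) (g, h)"
    by (simp add: awalk_direct_product)
  with p q show "has_walk (direct_product G H) (a, b) (g, h) m"
    by (auto simp: has_walk_def intro!: exI[of _ "zip p q"])
qed

text \<open>The iterated minimum is a lower bound for \<open>f\<close> on the product, and it is
  attained: take a minimizing \<open>a\<close>, then a minimizing \<open>b\<close> for it.\<close>

lemma Min_image_Times:
  fixes f :: "'a \<times> 'b \<Rightarrow> 'c::linorder"
  assumes "finite A" "A \<noteq> {}" "finite B" "B \<noteq> {}"
  shows "(MIN x \<in> A \<times> B. f x) = (MIN a \<in> A. MIN b \<in> B. f (a, b))"
proof (rule Min_eqI)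
  show "(MIN a \<in> A. MIN b \<in> B. f (a, b)) \<le> y" if "y \<in> f ` (A \<times> B)" for y
    using that assms by (auto simp: Min_le_iff)
  have "(MIN a \<in> A. MIN b \<in> B. f (a, b)) \<in> (\<lambda>a. MIN b \<in> B. f (a, b)) ` A"
    using assms by (intro Min_in) auto
  then obtain a where a: "a \<in> A" "(MIN a \<in> A. MIN b \<in> B. f (a, b)) = (MIN b \<in> B. f (a, b))"
    by auto
  have "(MIN b \<in> B. f (a, b)) \<in> (\<lambda>b. f (a, b)) ` B"
    using assms by (intro Min_in) auto
  with a show "(MIN a \<in> A. MIN b \<in> B. f (a, b)) \<in> f ` (A \<times> B)"
    by auto
qed (use assms in simp)

text \<open>The infimum in \<open>vdist\<close> for the product ranges over the common walk lengths
  of the two factors; it is \<infinity> if there are none.\<close>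

lemma root_dist_root_product:
  assumes "finite (verts R)" "verts R \<noteq> {}" "finite (verts S)" "verts S \<noteq> {}"
  shows "root_dist (direct_product G H) (root_product G R H S) (g, h) =
    (MIN a \<in> verts R. MIN b \<in> verts S. Inf {enat m | m. has_walk G a g m \<and> has_walk H b h m})"
  using assms
  by (simp add: root_dist_def root_product_def vdist_def Min_image_Times has_walk_direct_product)

lemma finite_verts_root:
  assumes "graph G" "is_root R G"
  shows "finite (verts R)"
proof -
  interpret graph G by fact
  show ?thesis
    using assms(2) by (auto simp: is_root_def induced_subgraph_def subgraph_def intro: finite_subset)
qed

text \<open>The indices of nonempty layers are exactly the values that \<open>root_dist\<close>
  takes on the vertices.\<close>

lemma Res_eq:
  "Res G R = G \<restriction> {x \<in> verts G. root_dist G R x = (MAX y \<in> verts G. root_dist G R y)}"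
proof -
  have "{i. layer G R i \<noteq> {}} = root_dist G R ` verts G"
    by (auto simp: layer_def)
  then show ?thesis
    by (simp add: Res_def layer_def)
qed

theorem theorem7:
  fixes G R\<^sub>G :: "('a,'b) pre_digraph" and H R\<^sub>H :: "('c,'d) pre_digraph"
  assumes "graph G" and "connected G"
    and "graph H" and "connected H"
    and "\<not> bipartite G \<or> \<not> bipartite H"
    and "is_root R\<^sub>G G" and "is_root R\<^sub>H H"
  shows "Res (direct_product G H) (root_product G R\<^sub>G H R\<^sub>H) =
    direct_product G H \<restriction>
      {(u,v) \<in> verts (direct_product G H).
        root_dist (direct_product G H) (root_product G R\<^sub>G H R\<^sub>H) (u,v) =
          (MAX (g,h) \<in> verts (direct_product G H).
            MIN r\<^sub>G \<in> verts R\<^sub>G. MIN r\<^sub>H \<in> verts R\<^sub>H.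
              Inf {enat m | m. has_walk G r\<^sub>G g m \<and> has_walk H r\<^sub>H h m})}"
proof -
  have R: "finite (verts R\<^sub>G)" "verts R\<^sub>G \<noteq> {}" "finite (verts R\<^sub>H)" "verts R\<^sub>H \<noteq> {}"
    using assms finite_verts_root by (auto simp: is_root_def)
  \<comment> \<open>An equation between functions, so that it also rewrites under the bound variable
    of the maximum in \<open>Res_eq\<close>.\<close>
  have "root_dist (direct_product G H) (root_product G R\<^sub>G H R\<^sub>H) =
    (\<lambda>(g,h). MIN r\<^sub>G \<in> verts R\<^sub>G. MIN r\<^sub>H \<in> verts R\<^sub>H.
      Inf {enat m | m. has_walk G r\<^sub>G g m \<and> has_walk H r\<^sub>H h m})"
    by (simp add: fun_eq_iff root_dist_root_product[OF R])
  then show ?thesis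
    by (simp add: Res_eq case_prod_beta')
qed

end
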